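(* For every $\alpha \in (0,\pi/2)$ and every $x \in (0,\alpha)$, we have $$\left(\frac{\sin \alpha}{\alpha}\right)^{\frac{x^2}{\alpha^2}} \;\leq\; \left(\frac{\sin \alpha}{\alpha}\right)^{\frac{x^4}{\alpha^4}} e^{\frac{x^4-\alpha^2 x^2}{6\alpha^2}} \;\leq\; \frac{\sin x}{x} \;\leq\; e^{-x^2/6}.$$
   Context: All powers are real powers of positive real numbers. *)

theory Defs
  imports Complex_Main
begin

end

theory Submission
  imports Defs "HOL-Real_Asymp.Real_Asymp"
begin

text \<open>
  Put \<open>f x = ln (sin x / x)\<close>. Its power series is \<open>- x^2/6 - x^4/180 - \<dots>\<close>, a series in
  \<open>x^2\<close> without constant term whose other coefficients are all negative. Hence \<open>f x \<le> - x^2/6\<close>, and the quotient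
  \<open>g x = (f x + x^2/6) / x^4\<close> is decreasing. On taking logarithms these two facts give
  everything: the rightmost inequality is the first fact at \<open>x\<close>, the middle one is
  \<open>g \<alpha> \<le> g x\<close>, and the leftmost one is the first fact at \<open>\<alpha>\<close> multiplied by
  \<open>(x^2/\<alpha>^2) (1 - x^2/\<alpha>^2) \<ge> 0\<close>.

  The series itself is avoided by differentiating. The sign of the derivative of
  \<open>f x + x^2/6\<close> is that of \<open>3 x cos x - 3 sin x + x^2 sin x\<close>. The sign of \<open>g'\<close> is that of
  \<open>h x = x f' x - 4 f x - x^2/3\<close>, which vanishes at \<open>0\<close>, and in the variable \<open>y = 2x\<close> the sign
  of \<open>h'\<close> is that of \<open>24 - 24 cos y - 4 y^2 - 9 y sin y + y^2 cos y\<close>. Remarkably, the third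
  derivative of this last expression is the first trigonometric polynomial again, whose own
  derivative is \<open>y (y cos y - sin y)\<close>. One chain of functions vanishing at \<open>0\<close>, each with
  the previous one as derivative (up to a positive factor), therefore settles both facts
  (\<open>ln_sinc_le\<close> and \<open>ln_sinc_remainder_antimono\<close>).
\<close>

section \<open>A sign criterion\<close>

lemma nonpos_if_deriv_nonpos:
  fixes f f' :: "real \<Rightarrow> real"
  assumes lim: "(f \<longlongrightarrow> 0) (at_right 0)"
    and deriv: "\<And>t. 0 < t \<Longrightarrow> t < b \<Longrightarrow> (f has_real_derivative f' t) (at t)"
    and nonpos: "\<And>t. 0 < t \<Longrightarrow> t < b \<Longrightarrow> f' t \<le> 0"
    and x: "0 < x" "x < b"
  shows "f x \<le> 0"
proof -
  have le: "f x \<le> f t" if t: "0 < t" "t < x" for t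
  proof (rule DERIV_nonpos_imp_nonincreasing[where f = f])
    show "t \<le> x" using t by simp
    show "\<exists>d. (f has_real_derivative d) (at s) \<and> d \<le> 0" if "t \<le> s" "s \<le> x" for s
      using deriv[of s] nonpos[of s] that t x by auto
  qed
  have "\<forall>\<^sub>F t in at_right 0. f x \<le> f t"
    unfolding eventually_at_right_field using le x by blast
  then show ?thesis
    by (rule tendsto_lowerbound[OF lim]) simp
qed

section \<open>A chain of trigonometric inequalities\<close>

lemma mult_cos_le_sin:
  fixes y :: real
  assumes "0 < y" "y < pi"
  shows "y * cos y - sin y \<le> 0"
proof (rule nonpos_if_deriv_nonpos[where f = "\<lambda>y. y * cos y - sin y"
      and b = pi and f' = "\<lambda>y. - (y * sin y)"])
  show "((\<lambda>y::real. y * cos y - sin y) \<longlongrightarrow> 0) (at_right 0)"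
    by (auto intro!: tendsto_eq_intros)
qed (use assms in \<open>auto intro!: derivative_eq_intros mult_nonneg_nonneg sin_ge_zero simp: algebra_simps\<close>)

text \<open>
  In each of the following lemmas the left-hand side vanishes at \<open>0\<close> and its derivative is the
  left-hand side of the lemma before, in \<open>trig_chain_1\<close> with an extra factor \<open>y\<close>.
\<close>

lemma trig_chain_1:
  fixes y :: real
  assumes "0 < y" "y < pi"
  shows "3 * y * cos y - 3 * sin y + y\<^sup>2 * sin y \<le> 0"
proof (rule nonpos_if_deriv_nonpos[where f = "\<lambda>y. 3 * y * cos y - 3 * sin y + y\<^sup>2 * sin y"
      and b = pi and f' = "\<lambda>y. y * (y * cos y - sin y)"])
  show "((\<lambda>y::real. 3 * y * cos y - 3 * sin y + y\<^sup>2 * sin y) \<longlongrightarrow> 0) (at_right 0)"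
    by (auto intro!: tendsto_eq_intros)
  show "t * (t * cos t - sin t) \<le> 0" if "0 < t" "t < pi" for t
    using mult_cos_le_sin[OF that] that by (intro mult_nonneg_nonpos) auto
qed (use assms in \<open>auto intro!: derivative_eq_intros simp: algebra_simps power2_eq_square\<close>)

lemma trig_chain_2:
  fixes y :: real
  assumes "0 < y" "y < pi"
  shows "8 * cos y - 8 + 5 * y * sin y - y\<^sup>2 * cos y \<le> 0"
proof (rule nonpos_if_deriv_nonpos[where f = "\<lambda>y. 8 * cos y - 8 + 5 * y * sin y - y\<^sup>2 * cos y"
      and b = pi and f' = "\<lambda>y. 3 * y * cos y - 3 * sin y + y\<^sup>2 * sin y"])
  show "((\<lambda>y::real. 8 * cos y - 8 + 5 * y * sin y - y\<^sup>2 * cos y) \<longlongrightarrow> 0) (at_right 0)"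
    by (auto intro!: tendsto_eq_intros)
qed (use assms trig_chain_1 in \<open>auto intro!: derivative_eq_intros simp: algebra_simps\<close>)

lemma trig_chain_3:
  fixes y :: real
  assumes "0 < y" "y < pi"
  shows "15 * sin y - 8 * y - 7 * y * cos y - y\<^sup>2 * sin y \<le> 0"
proof (rule nonpos_if_deriv_nonpos[where f = "\<lambda>y. 15 * sin y - 8 * y - 7 * y * cos y - y\<^sup>2 * sin y"
      and b = pi and f' = "\<lambda>y. 8 * cos y - 8 + 5 * y * sin y - y\<^sup>2 * cos y"])
  show "((\<lambda>y::real. 15 * sin y - 8 * y - 7 * y * cos y - y\<^sup>2 * sin y) \<longlongrightarrow> 0) (at_right 0)"
    by (auto intro!: tendsto_eq_intros)
qed (use assms trig_chain_2 in \<open>auto intro!: derivative_eq_intros simp: algebra_simps\<close>)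

lemma trig_chain_4:
  fixes y :: real
  assumes "0 < y" "y < pi"
  shows "24 - 24 * cos y - 4 * y\<^sup>2 - 9 * y * sin y + y\<^sup>2 * cos y \<le> 0"
proof (rule nonpos_if_deriv_nonpos[where f = "\<lambda>y. 24 - 24 * cos y - 4 * y\<^sup>2 - 9 * y * sin y + y\<^sup>2 * cos y"
      and b = pi and f' = "\<lambda>y. 15 * sin y - 8 * y - 7 * y * cos y - y\<^sup>2 * sin y"])
  show "((\<lambda>y::real. 24 - 24 * cos y - 4 * y\<^sup>2 - 9 * y * sin y + y\<^sup>2 * cos y) \<longlongrightarrow> 0) (at_right 0)"
    by (auto intro!: tendsto_eq_intros)
qed (use assms trig_chain_3 in \<open>auto intro!: derivative_eq_intros simp: algebra_simps\<close>)

section \<open>The logarithm of \<open>sin x / x\<close>\<close>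

lemma DERIV_ln_sinc:
  fixes t :: real
  assumes "0 < t" "t < pi"
  shows "((\<lambda>t. ln (sin t / t)) has_real_derivative cos t / sin t - 1 / t) (at t)"
proof -
  have s: "sin t > 0" using assms by (rule sin_gt_zero)
  have "((\<lambda>t. sin t / t) has_real_derivative (cos t * t - sin t * 1) / (t * t)) (at t)"
    using assms by (intro DERIV_divide DERIV_sin DERIV_ident) auto
  then have "((\<lambda>t. ln (sin t / t)) has_real_derivative
      1 / (sin t / t) * ((cos t * t - sin t * 1) / (t * t))) (at t)"
    by (rule DERIV_chain2[OF DERIV_ln_divide, rotated]) (use s assms in simp)
  also have "1 / (sin t / t) * ((cos t * t - sin t * 1) / (t * t)) = cos t / sin t - 1 / t"
    using s assms by (simp add: field_simps)
  finally show ?thesis .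
qed

lemma ln_sinc_le:
  fixes x :: real
  assumes "0 < x" "x < pi"
  shows "ln (sin x / x) \<le> - (x\<^sup>2 / 6)"
proof -
  have "ln (sin x / x) + x\<^sup>2 / 6 \<le> 0"
  proof (rule nonpos_if_deriv_nonpos[where f = "\<lambda>x. ln (sin x / x) + x\<^sup>2 / 6"
      and b = pi and f' = "\<lambda>t. (cos t / sin t - 1 / t) + t / 3"])
    show "((\<lambda>x::real. ln (sin x / x) + x\<^sup>2 / 6) \<longlongrightarrow> 0) (at_right 0)"
      by real_asymp
    fix t :: real assume t: "0 < t" "t < pi"
    show "((\<lambda>x. ln (sin x / x) + x\<^sup>2 / 6) has_real_derivative
        (cos t / sin t - 1 / t) + t / 3) (at t)"
      by (rule DERIV_add[OF DERIV_ln_sinc[OF t]]) (auto intro!: derivative_eq_intros)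
    have s: "sin t > 0" using t by (rule sin_gt_zero)
    have "cos t / sin t - 1 / t + t / 3
        = (3 * t * cos t - 3 * sin t + t\<^sup>2 * sin t) / (3 * t * sin t)"
      using s t by (simp add: field_simps power2_eq_square)
    also have "\<dots> \<le> 0"
      using trig_chain_1[OF t] s t by (intro divide_nonpos_pos) auto
    finally show "cos t / sin t - 1 / t + t / 3 \<le> 0" .
  qed (use assms in auto)
  then show ?thesis by simp
qed

text \<open>
  The left-hand side is \<open>x^5 g' x\<close>. Forming it removes the power of \<open>x\<close> in the denominator of
  \<open>g\<close> and cancels the \<open>x^4\<close> term of the series, so that one more differentiation leaves no
  logarithm. The bound \<open>pi / 2\<close> comes from the substitution \<open>y = 2t\<close> below.
\<close>

lemma ln_sinc_euler_le:
  fixes x :: real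
  assumes "0 < x" "x < pi / 2"
  shows "x * (cos x / sin x) - 1 - 4 * ln (sin x / x) - x\<^sup>2 / 3 \<le> 0"
proof (rule nonpos_if_deriv_nonpos[where f = "\<lambda>x. x * (cos x / sin x) - 1 - 4 * ln (sin x / x) - x\<^sup>2 / 3"
      and b = "pi / 2" and f' = "\<lambda>t. 4 / t - 3 * (cos t / sin t) - t / (sin t)\<^sup>2 - 2 * t / 3"])
  show "((\<lambda>x::real. x * (cos x / sin x) - 1 - 4 * ln (sin x / x) - x\<^sup>2 / 3) \<longlongrightarrow> 0) (at_right 0)"
    by real_asymp
  fix t :: real assume t: "0 < t" "t < pi / 2"
  have s: "sin t > 0" using t by (intro sin_gt_zero) auto
  have cot: "((\<lambda>t. cos t / sin t) has_real_derivative - (1 / (sin t)\<^sup>2)) (at t)"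
  proof -
    have "((\<lambda>t. cos t / sin t) has_real_derivative
        ((- sin t) * sin t - cos t * cos t) / (sin t * sin t)) (at t)"
      using s by (intro DERIV_divide DERIV_cos DERIV_sin) auto
    moreover have "(- sin t) * sin t - cos t * cos t = -1"
      using sin_cos_squared_add[of t] unfolding power2_eq_square by linarith
    ultimately show ?thesis by (simp add: power2_eq_square)
  qed
  have ln': "((\<lambda>t. ln (sin t / t)) has_real_derivative cos t / sin t - 1 / t) (at t)"
    using t by (intro DERIV_ln_sinc) auto
  show "((\<lambda>x. x * (cos x / sin x) - 1 - 4 * ln (sin x / x) - x\<^sup>2 / 3) has_real_derivative
      4 / t - 3 * (cos t / sin t) - t / (sin t)\<^sup>2 - 2 * t / 3) (at t)"
  proof -
    have "((\<lambda>x. x\<^sup>2 / 3) has_real_derivative 2 * t / 3) (at t)"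
      by (auto intro!: derivative_eq_intros)
    from DERIV_diff[OF DERIV_diff[OF DERIV_diff[OF DERIV_mult[OF DERIV_ident cot] DERIV_const]
          DERIV_cmult[OF ln']] this]
    show ?thesis by (rule DERIV_cong) (simp add: field_simps)
  qed
  \<comment> \<open>The double-angle formulas turn the quadratic terms in \<open>sin t\<close> and \<open>cos t\<close> into terms
      linear in \<open>sin (2 * t)\<close> and \<open>cos (2 * t)\<close>.\<close>
  have "24 - 24 * cos (2 * t) - 4 * (2 * t)\<^sup>2 - 9 * (2 * t) * sin (2 * t) + (2 * t)\<^sup>2 * cos (2 * t)
      = 12 * (4 * (sin t)\<^sup>2 - 3 * t * cos t * sin t - t\<^sup>2 - 2 * t\<^sup>2 * (sin t)\<^sup>2 / 3)"
    unfolding cos_double_sin sin_double by (simp add: algebra_simps)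
  with trig_chain_4[of "2 * t"] t
  have "4 * (sin t)\<^sup>2 - 3 * t * cos t * sin t - t\<^sup>2 - 2 * t\<^sup>2 * (sin t)\<^sup>2 / 3 \<le> 0"
    by simp
  moreover have "4 / t - 3 * (cos t / sin t) - t / (sin t)\<^sup>2 - 2 * t / 3
      = (4 * (sin t)\<^sup>2 - 3 * t * cos t * sin t - t\<^sup>2 - 2 * t\<^sup>2 * (sin t)\<^sup>2 / 3) / (t * (sin t)\<^sup>2)"
    using s t by (simp add: field_simps power2_eq_square)
  ultimately show "4 / t - 3 * (cos t / sin t) - t / (sin t)\<^sup>2 - 2 * t / 3 \<le> 0"
    using s t by (simp add: divide_nonpos_pos)
qed (use assms in auto)

lemma ln_sinc_remainder_antimono:
  fixes x a :: real
  assumes "0 < x" "x \<le> a" "a < pi / 2"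
  shows "(ln (sin a / a) + a\<^sup>2 / 6) / a ^ 4 \<le> (ln (sin x / x) + x\<^sup>2 / 6) / x ^ 4"
proof (rule DERIV_nonpos_imp_nonincreasing[OF assms(2)])
  fix t assume "x \<le> t" "t \<le> a"
  with assms have t: "0 < t" "t < pi / 2" by auto
  let ?D = "((cos t / sin t - 1 / t + t / 3) * t ^ 4
      - (ln (sin t / t) + t\<^sup>2 / 6) * (4 * t ^ 3)) / (t ^ 4 * t ^ 4)"
  have ln': "((\<lambda>t. ln (sin t / t)) has_real_derivative cos t / sin t - 1 / t) (at t)"
    using t by (intro DERIV_ln_sinc) auto
  have "((\<lambda>t. ln (sin t / t) + t\<^sup>2 / 6) has_real_derivative cos t / sin t - 1 / t + t / 3) (at t)"
    by (rule DERIV_add[OF ln']) (auto intro!: derivative_eq_intros)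
  moreover have "((\<lambda>t. t ^ 4) has_real_derivative 4 * t ^ 3) (at t)"
    by (auto intro!: derivative_eq_intros)
  ultimately have D: "((\<lambda>t. (ln (sin t / t) + t\<^sup>2 / 6) / t ^ 4) has_real_derivative ?D) (at t)"
    using t by (intro DERIV_divide) auto
  have eq: "?D = (t * (cos t / sin t) - 1 - 4 * ln (sin t / t) - t\<^sup>2 / 3) / t ^ 5"
  proof -
    have "(c - 1 / t + t / 3) * t ^ 4 - (l + t\<^sup>2 / 6) * (4 * t ^ 3)
        = t ^ 3 * (t * c - 1 - 4 * l - t\<^sup>2 / 3)" for c l
      using t by (simp add: field_simps eval_nat_numeral)
    moreover have "t ^ 4 * t ^ 4 = t ^ 3 * t ^ 5"
      by (simp flip: power_add)
    moreover have "t ^ 3 \<noteq> 0"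
      using t by simp
    ultimately show ?thesis
      by (simp only: mult_divide_mult_cancel_left not_False_eq_True)
  qed
  have "(t * (cos t / sin t) - 1 - 4 * ln (sin t / t) - t\<^sup>2 / 3) / t ^ 5 \<le> 0"
    using ln_sinc_euler_le[OF t] t by (intro divide_nonpos_pos) simp_all
  with D show "\<exists>d. ((\<lambda>t. (ln (sin t / t) + t\<^sup>2 / 6) / t ^ 4) has_real_derivative d) (at t) \<and> d \<le> 0"
    unfolding eq by blast
qed

section \<open>The chain of inequalities\<close>

theorem mainTheorem3:
  fixes \<alpha> x :: real
  assumes "\<alpha> \<in> {0<..<pi / 2}" and "x \<in> {0<..<\<alpha>}"
  shows "(sin \<alpha> / \<alpha>) powr (x ^ 2 / \<alpha> ^ 2)
           \<le> (sin \<alpha> / \<alpha>) powr (x ^ 4 / \<alpha> ^ 4) * exp ((x ^ 4 - \<alpha> ^ 2 * x ^ 2) / (6 * \<alpha> ^ 2))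
       \<and> (sin \<alpha> / \<alpha>) powr (x ^ 4 / \<alpha> ^ 4) * exp ((x ^ 4 - \<alpha> ^ 2 * x ^ 2) / (6 * \<alpha> ^ 2))
           \<le> sin x / x
       \<and> sin x / x \<le> exp (- (x ^ 2) / 6)"
proof -
  have x: "0 < x" "x < \<alpha>" "0 < \<alpha>" "\<alpha> < pi / 2" "x < pi" "\<alpha> < pi"
    using assms by auto
  define L where "L = ln (sin \<alpha> / \<alpha>)"
  define r where "r = x\<^sup>2 / \<alpha>\<^sup>2"
  have pos: "sin \<alpha> / \<alpha> > 0" "sin x / x > 0"
    using x by (auto intro!: divide_pos_pos sin_gt_zero)
  have powr: "(sin \<alpha> / \<alpha>) powr p = exp (p * L)" for p
    using pos unfolding powr_def L_def by auto
  have r4: "x ^ 4 / \<alpha> ^ 4 = r\<^sup>2"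
    unfolding r_def by (simp add: power_divide flip: power_mult)
  have x2: "x\<^sup>2 = r * \<alpha>\<^sup>2"
    using x by (simp add: r_def)
  have e: "(x ^ 4 - \<alpha> ^ 2 * x ^ 2) / (6 * \<alpha> ^ 2) = r\<^sup>2 * (\<alpha>\<^sup>2 / 6) - x\<^sup>2 / 6"
    using x by (simp add: r_def field_simps eval_nat_numeral)
  have r: "0 \<le> r" "r \<le> 1"
    using x by (auto simp: r_def power_mono)
  have "r * (1 - r) * (L + \<alpha>\<^sup>2 / 6) \<le> 0"
    using ln_sinc_le[of \<alpha>] x r by (intro mult_nonneg_nonpos) (auto simp: L_def)
  then have left: "r * L \<le> r\<^sup>2 * L + (r\<^sup>2 * (\<alpha>\<^sup>2 / 6) - x\<^sup>2 / 6)"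
    unfolding x2 by (simp add: field_simps power2_eq_square)
  have "(L + \<alpha>\<^sup>2 / 6) / \<alpha> ^ 4 \<le> (ln (sin x / x) + x\<^sup>2 / 6) / x ^ 4"
    unfolding L_def using x by (intro ln_sinc_remainder_antimono) auto
  then have "r\<^sup>2 * (L + \<alpha>\<^sup>2 / 6) \<le> ln (sin x / x) + x\<^sup>2 / 6"
    using x unfolding r4[symmetric] by (simp add: field_simps)
  then have middle: "r\<^sup>2 * L + (r\<^sup>2 * (\<alpha>\<^sup>2 / 6) - x\<^sup>2 / 6) \<le> ln (sin x / x)"
    by (simp add: algebra_simps)
  have right: "ln (sin x / x) \<le> - (x\<^sup>2) / 6"
    using ln_sinc_le[of x] x by simp
  have "exp (r * L) \<le> exp (r\<^sup>2 * L + (r\<^sup>2 * (\<alpha>\<^sup>2 / 6) - x\<^sup>2 / 6))"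
    using left by simp
  moreover have "exp (r\<^sup>2 * L + (r\<^sup>2 * (\<alpha>\<^sup>2 / 6) - x\<^sup>2 / 6)) \<le> sin x / x"
    using middle pos(2) by (simp add: ln_ge_iff)
  moreover have "sin x / x \<le> exp (- (x\<^sup>2) / 6)"
    using right pos(2) by (metis exp_le_cancel_iff exp_ln)
  ultimately show ?thesis
    unfolding powr r4 e r_def[symmetric] exp_add by blast
qed

end
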